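(* Assume the change-point model is Markovian, with sufficient statistic $\mathbb S_t\in\mathbb R^\kappa$, link function $\Psi$ and transition function $\Phi$. Let $c>0$, and let $(\mathcal X_c^*,T_c^* )$ be the procedure solving the auxiliary problem $\inf_{(\mathcal X,T)\in\mathcal C}\{c\,\mathsf E_{\gamma,\zeta}[T]+\mathsf P_{\gamma,\zeta}(T<\Theta_{\mathcal X})\}$ that is defined by $$T_c^*=\inf\{t\ge 0:\ 1/(1+\Gamma_t)\le J_c^*(\Gamma_t,\mathbb S_t,0)\},\qquad X^*_{t+1,c}=\arg\min_{k\in[K]}\mathcal T_{c,(k,0)}(J_c^* )(\Gamma_t,\mathbb S_t,0),\quad t\ge 0.$$ Then there exists a function $b_c:\mathbb R^\kappa\to\mathbb R_+=[0,\infty)$ such that $$T_c^*=\inf\{t\ge 0:\ \Gamma_t\ge b_c(\mathbb S_t)\}.$$ In the special case of the memoryless model (i.e. $\kappa=0$), the function $b_c$ is a constant.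
   Context: Setup. Fix $2\le K<\infty$, $[K]=\{1,\dots,K\}$, $\mathbb N=\{1,2,\dots\}$. On a probability space there is a latent process $L_t\in\{0,1\}$, $t\ge0$, with $L_t=0$ for $t<\Theta$ and $L_t=1$ for $t\ge\Theta$ ($\Theta$ is the change-point). At each time $t\in\mathbb N$ a treatment $X_t\in[K]$ is selected and a response $Y_t$ with values in a Polish space $\mathbb Y$ is observed; $\mathcal F_t=\sigma(X_s,Y_s:1\le s\le t)$, $\mathcal F_0$ trivial. An assignment rule $\mathcal X=\{X_t\}$ has $X_1$ deterministic and $X_t$ a (measurable) function of $X_1,\dots,X_{t-1},Y_1,\dots,Y_{t-1}$. Response model: for each $x\in[K]$, $f_x,g_x$ are densities with respect to a $\sigma$-finite measure $\mu$ on $\mathbb Y$; given $X_t=x$, $L_t=i$, $\mathcal F_{t-1}$ and $L_0,\dots,L_{t-1}$, the response $Y_t$ has density $f_x$ if $i=0$ and $g_x$ if $i=1$. Change-point model: $\mathsf P(L_0=1)=\pi_0\in[0,1)$ and $\mathsf P(L_t=1\mid L_{t-1}=0,\mathcal F_{t-1},X_t)=\Pi_t$. The change-point under $\mathcal X$ is denoted $\Theta_{\mathcal X}$. Markovian model: $\Pi_t=\Psi(X_t,\mathbb S_{t-1})$, $\mathbb S_t=\Phi(X_t,\mathbb S_{t-1})$ for $t\in\mathbb N$, where $\mathbb S_0\in\mathbb R^\kappa$ is deterministic, $\kappa\ge0$, $\Psi:[K]\times\mathbb R^\kappa\to[0,1)$ and $\Phi:[K]\times\mathbb R^\kappa\to\mathbb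 R^\kappa$. Memoryless means $\kappa=0$, i.e. $\Pi_t=\Psi(X_t)$. Posterior odds: $\Gamma_t=\mathsf P(L_t=1\mid\mathcal F_t)/\mathsf P(L_t=0\mid\mathcal F_t)$, $\Gamma_0=\pi_0/(1-\pi_0)$. $\mathcal C$ is the class of pairs $(\mathcal X,T)$ with $\mathcal X$ an assignment rule and $T$ an $\{\mathcal F_t\}$-stopping time. $\mathsf P_{\gamma,\zeta},\mathsf E_{\gamma,\zeta}$ denote probability and expectation when $\Gamma_0=\gamma\in[0,\infty)$ and $\mathbb S_0=\zeta\in\mathbb R^\kappa$. Define $J_c^*(\gamma,\zeta,0)=\inf_{(\mathcal X,T)\in\mathcal C}\{c\,\mathsf E_{\gamma,\zeta}[T]+\mathsf P_{\gamma,\zeta}(T<\Theta_{\mathcal X})\}$ and $J_c^*(\gamma,\zeta,1)=0$ (the third coordinate indicates whether the process has already been terminated). For a nonnegative function $J$ and $k\in[K]$, $$\mathcal T_{c,(k,0)}(J)(\gamma,\zeta,0)=c+\int_{\mathbb Y}J\Big(\tfrac{\gamma+\pi}{1-\pi}\tfrac{g_k(y)}{f_k(y)},\,\Phi(k,\zeta),\,0\Big)\tfrac{(\gamma+\pi)g_k(y)+(1-\pi)f_k(y)}{1+\gamma}\,\mu(dy),\quad \pi=\Psi(k,\zeta),$$ i.e. the cost of one more observation plus the expected value of $J$ after assigning treatment $k$ (the action "treatment $k$, do not stop" is written $(k,0)$). *)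

theory Defs
  imports "HOL-Probability.Probability"
begin

text \<open>
  The Euclidean space of dimension \<open>\<kappa>\<close>, where \<open>\<kappa> = 0\<close> must be allowed (a one-point space):
  vectors are the extensional functions on \<open>{..<\<kappa>}\<close>.
\<close>

definition euclid :: "nat \<Rightarrow> (nat \<Rightarrow> real) set" where
  "euclid \<kappa> = ({..<\<kappa>} \<rightarrow>\<^sub>E UNIV)"

record 'y cp_model =
  arms :: nat                                                        \<comment> \<open>\<open>K\<close>\<close>
  base :: "'y measure"                                               \<comment> \<open>\<open>\<mu>\<close>\<close>
  pre  :: "nat \<Rightarrow> 'y \<Rightarrow> real"                                         \<comment> \<open>\<open>f\<^sub>x\<close>\<close>
  post :: "nat \<Rightarrow> 'y \<Rightarrow> real"                                         \<comment> \<open>\<open>g\<^sub>x\<close>\<close>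
  stat_dim :: nat                                                        \<comment> \<open>\<open>\<kappa>\<close>\<close>
  link :: "nat \<Rightarrow> (nat \<Rightarrow> real) \<Rightarrow> real"                               \<comment> \<open>\<open>\<Psi>\<close>\<close>
  transition :: "nat \<Rightarrow> (nat \<Rightarrow> real) \<Rightarrow> (nat \<Rightarrow> real)"                     \<comment> \<open>\<open>\<Phi>\<close>\<close>

definition prob_density :: "'y measure \<Rightarrow> ('y \<Rightarrow> real) \<Rightarrow> bool" where
  "prob_density \<mu> h \<longleftrightarrow>
     h \<in> borel_measurable \<mu> \<and> (\<forall>y. 0 \<le> h y) \<and> (\<integral>\<^sup>+ y. ennreal (h y) \<partial>\<mu>) = 1"

definition markov_model :: "('y::polish_space) cp_model \<Rightarrow> bool" where
  "markov_model M \<longleftrightarrow>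
     2 \<le> arms M \<and>
     sets (base M) = sets borel \<and> sigma_finite_measure (base M) \<and>
     (\<forall>x\<in>{1..arms M}. prob_density (base M) (pre M x) \<and> prob_density (base M) (post M x)) \<and>
     (\<forall>x\<in>{1..arms M}. \<forall>s\<in>euclid (stat_dim M). link M x s \<in> {0..<1} \<and> transition M x s \<in> euclid (stat_dim M))"

text \<open>
  Sample space: a path \<open>\<omega>\<close> has \<open>\<omega> t = (L\<^sub>t, Y\<^sub>t)\<close>, with \<open>True\<close> for \<open>L\<^sub>t = 1\<close>; the response
  component of \<open>\<omega> 0\<close> is a dummy.  Treatments and sufficient statistics are functions of the path.
\<close>

type_synonym 'y path = "nat \<Rightarrow> bool \<times> 'y"

definition coord_space :: "(bool \<times> 'y::polish_space) measure" where
  "coord_space = count_space UNIV \<Otimes>\<^sub>M borel"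

definition latent :: "nat \<Rightarrow> 'y path \<Rightarrow> bool" where
  "latent t \<omega> = fst (\<omega> t)"

definition response :: "nat \<Rightarrow> 'y path \<Rightarrow> 'y" where
  "response t \<omega> = snd (\<omega> t)"

definition change_point :: "'y path \<Rightarrow> enat" where
  "change_point \<omega> = (INF t\<in>{t. latent t \<omega>}. enat t)"

text \<open>
  An assignment rule \<open>\<delta>\<close> yields \<open>X\<^sub>t = \<delta> t (X\<^sub>s, Y\<^sub>s)\<^sub>1\<^sub>\<le>\<^sub>s\<^sub><\<^sub>t\<close>.  The history space for \<open>t = 1\<close> has a
  single point, so \<open>X\<^sub>1\<close> is deterministic.
\<close>

type_synonym 'y rule = "nat \<Rightarrow> (nat \<Rightarrow> nat \<times> 'y) \<Rightarrow> nat"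

definition hist_space :: "('y::polish_space) cp_model \<Rightarrow> nat set \<Rightarrow> (nat \<Rightarrow> nat \<times> 'y) measure" where
  "hist_space M I = (\<Pi>\<^sub>M s\<in>I. count_space {1..arms M} \<Otimes>\<^sub>M borel)"

definition assignment_rule :: "('y::polish_space) cp_model \<Rightarrow> 'y rule \<Rightarrow> bool" where
  "assignment_rule M \<delta> \<longleftrightarrow>
     (\<forall>t\<ge>1. \<delta> t \<in> hist_space M {1..<t} \<rightarrow>\<^sub>M count_space {1..arms M})"

function treatment :: "'y rule \<Rightarrow> nat \<Rightarrow> 'y path \<Rightarrow> nat" where
  "treatment \<delta> t \<omega> =
     \<delta> t (\<lambda>s. if s \<in> {1..<t} then (treatment \<delta> s \<omega>, response s \<omega>) else undefined)"
  by pat_completeness auto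
termination by (relation "Wellfounded.measure (\<lambda>(\<delta>, t, \<omega>). t)") auto

declare treatment.simps [simp del]

primrec stat :: "'y cp_model \<Rightarrow> (nat \<Rightarrow> real) \<Rightarrow> (nat \<Rightarrow> nat) \<Rightarrow> nat \<Rightarrow> (nat \<Rightarrow> real)" where
  "stat M \<zeta> x 0 = \<zeta>"
| "stat M \<zeta> x (Suc t) = transition M (x (Suc t)) (stat M \<zeta> x t)"

definition suff_stat ::
  "'y cp_model \<Rightarrow> 'y rule \<Rightarrow> (nat \<Rightarrow> real) \<Rightarrow> nat \<Rightarrow> 'y path \<Rightarrow> (nat \<Rightarrow> real)" where
  "suff_stat M \<delta> \<zeta> t \<omega> = stat M \<zeta> (\<lambda>s. treatment \<delta> s \<omega>) t"

definition filt :: "('y::polish_space) cp_model \<Rightarrow> 'y rule \<Rightarrow> nat \<Rightarrow> 'y path measure" where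
  "filt M \<delta> t =
     vimage_algebra UNIV (\<lambda>\<omega>. \<lambda>s\<in>{1..t}. (treatment \<delta> s \<omega>, response s \<omega>)) (hist_space M {1..t})"

text \<open>
  Odds take values in \<open>[0, \<infinity>]\<close>: the posterior odds become infinite after a response at which
  the pre-change density vanishes.  Odds \<open>\<infinity>\<close> correspond to \<open>\<pi>\<^sub>0 = 1\<close>.
\<close>

definition prior_prob :: "ennreal \<Rightarrow> real" where
  "prior_prob \<gamma> = (if \<gamma> = \<infinity> then 1 else enn2real \<gamma> / (1 + enn2real \<gamma>))"

text \<open>
  Conditional law of \<open>(L\<^sub>t, Y\<^sub>t)\<close> given \<open>(L\<^sub>s, Y\<^sub>s)\<^sub>s\<^sub><\<^sub>t\<close>: for \<open>t \<ge> 1\<close>, with \<open>x = X\<^sub>t\<close>, the state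
  \<open>L\<^sub>t\<close> is \<open>1\<close> with probability \<open>\<Pi>\<^sub>t = \<Psi>(X\<^sub>t, S\<^sub>t\<^sub>-\<^sub>1)\<close> if \<open>L\<^sub>t\<^sub>-\<^sub>1 = 0\<close> and surely if \<open>L\<^sub>t\<^sub>-\<^sub>1 = 1\<close>,
  and \<open>Y\<^sub>t\<close> then has density \<open>f\<^sub>x\<close> or \<open>g\<^sub>x\<close> according to \<open>L\<^sub>t\<close>.
\<close>

definition step_kernel ::
  "('y::polish_space) cp_model \<Rightarrow> 'y rule \<Rightarrow> ennreal \<Rightarrow> (nat \<Rightarrow> real) \<Rightarrow> nat \<Rightarrow> 'y path \<Rightarrow>
     (bool \<times> 'y) measure" where
  "step_kernel M \<delta> \<gamma> \<zeta> t \<omega> =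
     (if t = 0 then
        distr (measure_pmf (bernoulli_pmf (prior_prob \<gamma>))) coord_space (\<lambda>l. (l, undefined))
      else
        let x = treatment \<delta> t \<omega>;
            p = (if latent (t - 1) \<omega> then 1 else link M x (suff_stat M \<delta> \<zeta> (t - 1) \<omega>))
        in density (measure_pmf (bernoulli_pmf p) \<Otimes>\<^sub>M base M)
             (\<lambda>(l, y). ennreal (if l then post M x y else pre M x y)))"

definition law ::
  "('y::polish_space) cp_model \<Rightarrow> 'y rule \<Rightarrow> ennreal \<Rightarrow> (nat \<Rightarrow> real) \<Rightarrow> 'y path measure" where
  "law M \<delta> \<gamma> \<zeta> =
     projective_family.lim UNIV
       (Ionescu_Tulcea.CI (step_kernel M \<delta> \<gamma> \<zeta>) (\<lambda>_. coord_space)) (\<lambda>_. coord_space)"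

lemma space_coord_space [simp]: "space coord_space = UNIV"
  by (simp add: coord_space_def space_pair_measure)

lemma treatment_measurable:
  assumes "assignment_rule M \<delta>" "1 \<le> t" "{1..<t} \<subseteq> I"
  shows "treatment \<delta> t \<in> (\<Pi>\<^sub>M i\<in>I. coord_space) \<rightarrow>\<^sub>M count_space {1..arms M}"
  using assms(2,3)
proof (induction t rule: less_induct)
  case (less t)
  let ?h = "\<lambda>\<omega> s. if s \<in> {1..<t} then (treatment \<delta> s \<omega>, response s \<omega>) else undefined"
  have "(\<lambda>\<omega>. \<lambda>s\<in>{1..<t}. (treatment \<delta> s \<omega>, response s \<omega>))
      \<in> (\<Pi>\<^sub>M i\<in>I. coord_space) \<rightarrow>\<^sub>M hist_space M {1..<t}"
    unfolding hist_space_def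
  proof (rule measurable_restrict)
    fix s assume s: "s \<in> {1..<t}"
    have "treatment \<delta> s \<in> (\<Pi>\<^sub>M i\<in>I. coord_space) \<rightarrow>\<^sub>M count_space {1..arms M}"
      using s less.prems by (intro less.IH) auto
    moreover have "(\<lambda>\<omega>. \<omega> s) \<in> (\<Pi>\<^sub>M i\<in>I. coord_space) \<rightarrow>\<^sub>M coord_space"
      using s less.prems by (intro measurable_component_singleton) auto
    then have "response s \<in> (\<Pi>\<^sub>M i\<in>I. coord_space) \<rightarrow>\<^sub>M borel"
      unfolding response_def coord_space_def by measurable
    ultimately show "(\<lambda>\<omega>. (treatment \<delta> s \<omega>, response s \<omega>))
        \<in> (\<Pi>\<^sub>M i\<in>I. coord_space) \<rightarrow>\<^sub>M count_space {1..arms M} \<Otimes>\<^sub>M borel"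
      by (rule measurable_Pair)
  qed
  then have "?h \<in> (\<Pi>\<^sub>M i\<in>I. coord_space) \<rightarrow>\<^sub>M hist_space M {1..<t}"
    by (simp add: restrict_def)
  moreover have "\<delta> t \<in> hist_space M {1..<t} \<rightarrow>\<^sub>M count_space {1..arms M}"
    using assms(1) less.prems by (simp add: assignment_rule_def)
  ultimately have "(\<lambda>\<omega>. \<delta> t (?h \<omega>)) \<in> (\<Pi>\<^sub>M i\<in>I. coord_space) \<rightarrow>\<^sub>M count_space {1..arms M}"
    by (rule measurable_compose)
  moreover have "treatment \<delta> t = (\<lambda>\<omega>. \<delta> t (?h \<omega>))"
    by (rule ext) (rule treatment.simps)
  ultimately show ?case by simp
qed

lemma stat_cong: "(\<And>s. 1 \<le> s \<Longrightarrow> s \<le> t \<Longrightarrow> x s = x' s) \<Longrightarrow> stat M \<zeta> x t = stat M \<zeta> x' t"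
  by (induction t) auto

lemma stat_in_euclid:
  assumes "markov_model M" "\<zeta> \<in> euclid (stat_dim M)" "\<And>s. 1 \<le> s \<Longrightarrow> s \<le> t \<Longrightarrow> x s \<in> {1..arms M}"
  shows "stat M \<zeta> x t \<in> euclid (stat_dim M)"
  using assms(3) by (induction t) (use assms in \<open>auto simp: markov_model_def\<close>)

lemma prior_prob_bounds: "0 \<le> prior_prob \<gamma>" "prior_prob \<gamma> \<le> 1"
  by (auto simp: prior_prob_def add_nonneg_nonneg intro!: divide_nonneg_nonneg divide_le_eq_1_pos[THEN iffD2] add_pos_nonneg)

lemma response_density_prob:
  fixes M :: "('y::polish_space) cp_model"
  assumes M: "markov_model M" and x: "x \<in> {1..arms M}"
  shows "density (measure_pmf q \<Otimes>\<^sub>M base M)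
             (\<lambda>(l, y). ennreal (if l then post M x y else pre M x y))
           \<in> space (prob_algebra coord_space)"
proof -
  interpret sigma_finite_measure "base M"
    using M by (simp add: markov_model_def)
  have [measurable_cong]: "sets (base M) = sets borel"
    using M by (simp add: markov_model_def)
  have d: "prob_density (base M) (pre M x)" "prob_density (base M) (post M x)"
    using M x by (auto simp: markov_model_def)
  have [measurable]: "pre M x \<in> borel_measurable (base M)" "post M x \<in> borel_measurable (base M)"
    using d by (auto simp: prob_density_def)
  let ?D = "\<lambda>(l, y). ennreal (if l then post M x y else pre M x y)"
  have D: "?D \<in> borel_measurable (measure_pmf q \<Otimes>\<^sub>M base M)"
    by measurable
  have "emeasure (density (measure_pmf q \<Otimes>\<^sub>M base M) ?D)
          (space (measure_pmf q \<Otimes>\<^sub>M base M)) = (\<integral>\<^sup>+ z. ?D z \<partial>(measure_pmf q \<Otimes>\<^sub>M base M))"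
    using D by (subst emeasure_density) (auto intro!: nn_integral_cong)
  also have "\<dots> = (\<integral>\<^sup>+ l. \<integral>\<^sup>+ y. ?D (l, y) \<partial>base M \<partial>measure_pmf q)"
    by (rule nn_integral_fst[symmetric, OF D])
  also have "\<dots> = (\<integral>\<^sup>+ l. 1 \<partial>measure_pmf q)"
  proof (rule nn_integral_cong)
    show "(\<integral>\<^sup>+ y. ?D (l, y) \<partial>base M) = 1" for l
      using d by (cases l) (auto simp: prob_density_def)
  qed
  also have "\<dots> = 1"
    by simp
  finally have "prob_space (density (measure_pmf q \<Otimes>\<^sub>M base M) ?D)"
    by (intro prob_spaceI) simp
  moreover have "sets (density (measure_pmf q \<Otimes>\<^sub>M base M) ?D) = sets coord_space"
    unfolding coord_space_def sets_density
    by (rule sets_pair_measure_cong) (use M in \<open>auto simp: markov_model_def\<close>)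
  ultimately show ?thesis
    by (simp add: space_prob_algebra)
qed

lemma step_kernel_measurable:
  fixes M :: "('y::polish_space) cp_model"
  assumes M: "markov_model M" and \<delta>: "assignment_rule M \<delta>"
  shows "step_kernel M \<delta> \<gamma> \<zeta> t \<in> (\<Pi>\<^sub>M i\<in>{0..<t}. coord_space) \<rightarrow>\<^sub>M prob_algebra coord_space"
proof (cases "t = 0")
  case True
  have "(\<lambda>l. (l, undefined)) \<in> measure_pmf (bernoulli_pmf (prior_prob \<gamma>)) \<rightarrow>\<^sub>M
      (coord_space :: (bool \<times> 'y) measure)"
    by (simp add: Pi_iff)
  then have "prob_space (distr (measure_pmf (bernoulli_pmf (prior_prob \<gamma>)))
      (coord_space :: (bool \<times> 'y) measure) (\<lambda>l. (l, undefined)))"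
    by (rule measure_pmf.prob_space_distr)
  then have "distr (measure_pmf (bernoulli_pmf (prior_prob \<gamma>)))
      (coord_space :: (bool \<times> 'y) measure) (\<lambda>l. (l, undefined)) \<in> space (prob_algebra coord_space)"
    by (simp add: space_prob_algebra)
  then show ?thesis
    using True by (simp add: step_kernel_def[abs_def])
next
  case False
  let ?N = "\<Pi>\<^sub>M i\<in>{0..<t}. (coord_space :: (bool \<times> 'y) measure)"
  define H where "H = ({1..t} \<rightarrow>\<^sub>E {1..arms M})"
  define G where "G = (\<lambda>(x, l). density (measure_pmf (bernoulli_pmf
      (if l then 1 else link M (x t) (stat M \<zeta> x (t - 1)))) \<Otimes>\<^sub>M base M)
      (\<lambda>(l, y). ennreal (if l then post M (x t) y else pre M (x t) y)))"
  have "(\<lambda>\<omega>. \<lambda>s\<in>{1..t}. treatment \<delta> s \<omega>) \<in> ?N \<rightarrow>\<^sub>M (\<Pi>\<^sub>M s\<in>{1..t}. count_space {1..arms M})"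
    by (intro measurable_restrict treatment_measurable[OF \<delta>]) auto
  then have x: "(\<lambda>\<omega>. \<lambda>s\<in>{1..t}. treatment \<delta> s \<omega>) \<in> ?N \<rightarrow>\<^sub>M count_space H"
    by (simp add: H_def count_space_PiM_finite)
  have "(\<lambda>\<omega>. \<omega> (t - 1)) \<in> ?N \<rightarrow>\<^sub>M coord_space"
    using False by (intro measurable_component_singleton) auto
  then have l: "latent (t - 1) \<in> ?N \<rightarrow>\<^sub>M count_space UNIV"
    unfolding latent_def coord_space_def by measurable
  have "finite H"
    by (simp add: H_def finite_PiE)
  then have "count_space H \<Otimes>\<^sub>M count_space (UNIV :: bool set) = count_space (H \<times> UNIV)"
    by (intro pair_measure_count_space) auto
  then have xl: "(\<lambda>\<omega>. (\<lambda>s\<in>{1..t}. treatment \<delta> s \<omega>, latent (t - 1) \<omega>)) \<in> ?N \<rightarrow>\<^sub>M count_space (H \<times> UNIV)"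
    using measurable_Pair[OF x l] by simp
  have "G \<in> count_space (H \<times> UNIV) \<rightarrow>\<^sub>M prob_algebra coord_space"
    using False response_density_prob[OF M] by (auto simp: G_def H_def PiE_iff)
  from measurable_compose[OF xl this] show ?thesis
  proof (rule measurable_cong[THEN iffD1, rotated])
    fix \<omega> assume "\<omega> \<in> space ?N"
    have "stat M \<zeta> (\<lambda>s\<in>{1..t}. treatment \<delta> s \<omega>) (t - 1) = suff_stat M \<delta> \<zeta> (t - 1) \<omega>"
      unfolding suff_stat_def by (rule stat_cong) auto
    moreover have "(\<lambda>s\<in>{1..t}. treatment \<delta> s \<omega>) t = treatment \<delta> t \<omega>"
      using False by simp
    ultimately show "G (\<lambda>s\<in>{1..t}. treatment \<delta> s \<omega>, latent (t - 1) \<omega>) = step_kernel M \<delta> \<gamma> \<zeta> t \<omega>"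
      using False by (simp only: G_def step_kernel_def Let_def prod.case if_False)
  qed
qed

lemma Ionescu_Tulcea_step_kernel:
  fixes M :: "('a::polish_space) cp_model"
  assumes "markov_model M" "assignment_rule M \<delta>"
  shows "Ionescu_Tulcea (step_kernel M \<delta> \<gamma> \<zeta>) (\<lambda>_. coord_space)"
proof (rule Ionescu_Tulcea.intro)
  fix i
  note k = step_kernel_measurable[OF assms, of \<gamma> \<zeta> i]
  show "step_kernel M \<delta> \<gamma> \<zeta> i \<in> (\<Pi>\<^sub>M i\<in>{0..<i}. coord_space) \<rightarrow>\<^sub>M subprob_algebra coord_space"
    using k by (rule measurable_prob_algebraD)
  fix x assume "x \<in> space (\<Pi>\<^sub>M i\<in>{0..<i}. (coord_space :: (bool \<times> 'a) measure))"
  from measurable_space[OF k this] show "prob_space (step_kernel M \<delta> \<gamma> \<zeta> i x)"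
    by (simp add: space_prob_algebra)
qed

lemma
  fixes M :: "('a::polish_space) cp_model"
  assumes "markov_model M" "assignment_rule M \<delta>"
  shows sets_law: "sets (law M \<delta> \<gamma> \<zeta>) = sets (\<Pi>\<^sub>M i\<in>UNIV. coord_space)"
    and prob_space_law: "prob_space (law M \<delta> \<gamma> \<zeta>)"
proof -
  interpret Ionescu_Tulcea "step_kernel M \<delta> \<gamma> \<zeta>" "\<lambda>_. coord_space"
    by (rule Ionescu_Tulcea_step_kernel[OF assms])
  show s: "sets (law M \<delta> \<gamma> \<zeta>) = sets (\<Pi>\<^sub>M i\<in>UNIV. coord_space)"
    by (simp add: law_def)
  have "emeasure PF.lim (PF.emb UNIV {} {\<lambda>_. undefined}) = emeasure (CI {}) {\<lambda>_. undefined}"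
    by (rule lim) (auto simp: sets_PiM_empty)
  also have "\<dots> = 1"
    using prob_space.emeasure_space_1[OF PF.prob_space_P[of "{}"]] PF.space_P[of "{}"] by (simp add: space_PiM)
  also have "PF.emb UNIV {} {\<lambda>_. undefined} = space PF.lim"
    by (auto simp: prod_emb_def space_PiM)
  finally show "prob_space (law M \<delta> \<gamma> \<zeta>)"
    by (intro prob_spaceI) (simp add: law_def)
qed

text \<open>
  Conditional probabilities are only determined almost surely, so the posterior odds are any
  adapted version \<open>\<Gamma>\<close> of the quotient.
\<close>

definition posterior_odds ::
  "('y::polish_space) cp_model \<Rightarrow> 'y rule \<Rightarrow> ennreal \<Rightarrow> (nat \<Rightarrow> real) \<Rightarrow>
     (nat \<Rightarrow> 'y path \<Rightarrow> ennreal) \<Rightarrow> bool" where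
  "posterior_odds M \<delta> \<gamma> \<zeta> \<Gamma> \<longleftrightarrow>
     (\<forall>t. \<Gamma> t \<in> borel_measurable (filt M \<delta> t) \<and>
        (AE \<omega> in law M \<delta> \<gamma> \<zeta>.
           \<Gamma> t \<omega> =
             nn_cond_exp (law M \<delta> \<gamma> \<zeta>) (filt M \<delta> t) (indicator {\<omega>. latent t \<omega>}) \<omega> /
             nn_cond_exp (law M \<delta> \<gamma> \<zeta>) (filt M \<delta> t) (indicator {\<omega>. \<not> latent t \<omega>}) \<omega>))"

definition procedures :: "('y::polish_space) cp_model \<Rightarrow> ('y rule \<times> ('y path \<Rightarrow> enat)) set" where
  "procedures M =
     {(\<delta>, T). assignment_rule M \<delta> \<and> (\<forall>t. Measurable.pred (filt M \<delta> t) (\<lambda>\<omega>. T \<omega> \<le> enat t))}"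

definition aux_cost ::
  "('y::polish_space) cp_model \<Rightarrow> real \<Rightarrow> ennreal \<Rightarrow> (nat \<Rightarrow> real) \<Rightarrow>
     'y rule \<Rightarrow> ('y path \<Rightarrow> enat) \<Rightarrow> ennreal" where
  "aux_cost M c \<gamma> \<zeta> \<delta> T =
     ennreal c * (\<integral>\<^sup>+ \<omega>. ennreal_of_enat (T \<omega>) \<partial>law M \<delta> \<gamma> \<zeta>) +
     emeasure (law M \<delta> \<gamma> \<zeta>) {\<omega>. T \<omega> < change_point \<omega>}"

definition opt_cost ::
  "('y::polish_space) cp_model \<Rightarrow> real \<Rightarrow> ennreal \<Rightarrow> (nat \<Rightarrow> real) \<Rightarrow> bool \<Rightarrow> ennreal" where
  "opt_cost M c \<gamma> \<zeta> stopped =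
     (if stopped then 0 else (INF (\<delta>, T)\<in>procedures M. aux_cost M c \<gamma> \<zeta> \<delta> T))"

definition bellman_op ::
  "('y::polish_space) cp_model \<Rightarrow> real \<Rightarrow> nat \<Rightarrow> (ennreal \<Rightarrow> (nat \<Rightarrow> real) \<Rightarrow> bool \<Rightarrow> ennreal) \<Rightarrow>
     ennreal \<Rightarrow> (nat \<Rightarrow> real) \<Rightarrow> ennreal" where
  "bellman_op M c k J \<gamma> \<zeta> =
     (let p = link M k \<zeta> in
      ennreal c +
      (\<integral>\<^sup>+ y. J ((\<gamma> + ennreal p) / ennreal (1 - p) * (ennreal (post M k y) / ennreal (pre M k y)))
               (transition M k \<zeta>) False *
             (((\<gamma> + ennreal p) * ennreal (post M k y) + ennreal (1 - p) * ennreal (pre M k y)) /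
              (1 + \<gamma>)) \<partial>base M))"

text \<open>
  \<open>(\<delta>, T)\<close> is the procedure \<open>(\<X>\<^sub>c\<^sup>*, T\<^sub>c\<^sup>*)\<close> for the initial values \<open>\<gamma>, \<zeta>\<close>,
  where \<open>\<Gamma>\<close> is its posterior odds process; ties in the minimum may be broken arbitrarily.
\<close>

definition star_procedure ::
  "('y::polish_space) cp_model \<Rightarrow> real \<Rightarrow> ennreal \<Rightarrow> (nat \<Rightarrow> real) \<Rightarrow>
     (nat \<Rightarrow> 'y path \<Rightarrow> ennreal) \<Rightarrow> 'y rule \<Rightarrow> ('y path \<Rightarrow> enat) \<Rightarrow> bool" where
  "star_procedure M c \<gamma> \<zeta> \<Gamma> \<delta> T \<longleftrightarrow>
     assignment_rule M \<delta> \<and>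
     posterior_odds M \<delta> \<gamma> \<zeta> \<Gamma> \<and>
     (\<forall>t \<omega>. is_arg_min
        (\<lambda>k. bellman_op M c k (opt_cost M c) (\<Gamma> t \<omega>) (suff_stat M \<delta> \<zeta> t \<omega>))
        (\<lambda>k. k \<in> {1..arms M}) (treatment \<delta> (Suc t) \<omega>)) \<and>
     (\<forall>\<omega>. T \<omega> =
        (INF t\<in>{t. 1 / (1 + \<Gamma> t \<omega>) \<le> opt_cost M c (\<Gamma> t \<omega>) (suff_stat M \<delta> \<zeta> t \<omega>) False}. enat t))"

end

theory Submission
  imports Defs
begin

text \<open>
  The laws for different initial odds \<open>\<gamma>\<close> differ only in the law of \<open>L\<^sub>0\<close>, so the law for
  \<open>\<gamma>\<close> is the mixture of those for \<open>\<infinity>\<close> and \<open>0\<close> with weights \<open>\<gamma>/(1+\<gamma>)\<close> and \<open>1/(1+\<gamma>)\<close>.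
  Hence \<open>(1+\<gamma>)\<close> times the cost of a fixed procedure is an affine function of \<open>\<gamma>\<close> with nonnegative slope,
  and stopping is optimal at \<open>\<gamma>\<close> iff all these affine functions are at least \<open>1\<close>.  The
  stopping set is therefore upward closed.  It contains \<open>1/c\<close>: as \<open>\<F>\<^sub>0\<close> is trivial, a procedure
  either stops at once or takes an observation, and then the slope is at least \<open>c\<close>.  It is closed because
  procedures can be truncated at a finite horizon, where the slope is finite.  So it is a half-line
  \<open>[b, \<infinity>]\<close>.
\<close>

context
  fixes M :: "('y::polish_space) cp_model" and \<delta> :: "'y rule"
  assumes M: "markov_model M" and \<delta>: "assignment_rule M \<delta>"
begin

lemma nn_integral_initial_step:
  assumes f [measurable]: "f \<in> borel_measurable (\<Pi>\<^sub>M i\<in>{0::nat..<1}. coord_space)"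
  shows "(\<integral>\<^sup>+ x. f x \<partial>Ionescu_Tulcea.C (step_kernel M \<delta> \<gamma> \<zeta>) (\<lambda>_. coord_space) 0 1 (\<lambda>_. undefined)) =
    (\<integral>\<^sup>+ l. f ((\<lambda>_. undefined)(0 := (l, undefined))) \<partial>measure_pmf (bernoulli_pmf (prior_prob \<gamma>)))"
proof -
  interpret Ionescu_Tulcea "step_kernel M \<delta> \<gamma> \<zeta>" "\<lambda>_. coord_space"
    by (rule Ionescu_Tulcea_step_kernel[OF M \<delta>])
  let ?u = "\<lambda>_. undefined :: bool \<times> 'y"
  have u: "?u \<in> space (\<Pi>\<^sub>M i\<in>{0::nat..<0}. coord_space)"
    by (simp add: space_PiM)
  have upd: "(\<lambda>z. ?u(0 := z)) \<in> coord_space \<rightarrow>\<^sub>M (\<Pi>\<^sub>M i\<in>{0::nat..<1}. coord_space)"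
    by (rule measurable_fun_upd[where J = "{}"]) (auto simp: space_PiM)
  have "C 0 1 ?u = eP 0 ?u"
    using bind_return[OF measurable_eP u] by simp
  then have "(\<integral>\<^sup>+ x. f x \<partial>C 0 1 ?u) = (\<integral>\<^sup>+ z. f (?u(0 := z)) \<partial>step_kernel M \<delta> \<gamma> \<zeta> 0 ?u)"
    using nn_integral_eP[OF u, of f] f by simp
  also have "\<dots> = (\<integral>\<^sup>+ l. f (?u(0 := (l, undefined))) \<partial>measure_pmf (bernoulli_pmf (prior_prob \<gamma>)))"
    unfolding step_kernel_def
    using measurable_compose[OF upd f] by (simp add: nn_integral_distr Pi_iff)
  finally show ?thesis .
qed

lemma nn_integral_finite_horizon_mixture:
  assumes "1 \<le> n" and "f \<in> borel_measurable (\<Pi>\<^sub>M i\<in>{0::nat..<n}. coord_space)"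
  shows "(\<integral>\<^sup>+ x. f x \<partial>Ionescu_Tulcea.C (step_kernel M \<delta> \<gamma> \<zeta>) (\<lambda>_. coord_space) 0 n (\<lambda>_. undefined)) =
    ennreal (prior_prob \<gamma>) *
      (\<integral>\<^sup>+ x. f x \<partial>Ionescu_Tulcea.C (step_kernel M \<delta> \<infinity> \<zeta>) (\<lambda>_. coord_space) 0 n (\<lambda>_. undefined)) +
    ennreal (1 - prior_prob \<gamma>) *
      (\<integral>\<^sup>+ x. f x \<partial>Ionescu_Tulcea.C (step_kernel M \<delta> 0 \<zeta>) (\<lambda>_. coord_space) 0 n (\<lambda>_. undefined))"
  using assms
proof (induction n arbitrary: f rule: dec_induct)
  case base
  have "f \<in> borel_measurable (\<Pi>\<^sub>M i\<in>{0::nat..<1}. coord_space)"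
    using base by simp
  moreover have "prior_prob 0 = 0" "prior_prob \<infinity> = 1"
    by (simp_all add: prior_prob_def)
  ultimately show ?case
    using prior_prob_bounds[of \<gamma>] by (simp only: nn_integral_initial_step) (simp add: mult.commute)
next
  case (step n)
  let ?u = "\<lambda>_. undefined :: bool \<times> 'y"
  let ?S = "\<lambda>n. \<Pi>\<^sub>M i\<in>{0::nat..<n}. (coord_space :: (bool \<times> 'y) measure)"
  let ?C = "\<lambda>\<gamma>. Ionescu_Tulcea.C (step_kernel M \<delta> \<gamma> \<zeta>) (\<lambda>_. coord_space)"
  define E where "E = Ionescu_Tulcea.eP (step_kernel M \<delta> 0 \<zeta>) (\<lambda>_. coord_space) n"
  have u: "?u \<in> space (?S 0)"
    by (simp add: space_PiM)
  have E_eq: "Ionescu_Tulcea.eP (step_kernel M \<delta> \<gamma>' \<zeta>) (\<lambda>_. coord_space) n = E" for \<gamma>'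
    unfolding E_def using step.hyps
    by (simp add: fun_eq_iff step_kernel_def
        Ionescu_Tulcea.eP_def[OF Ionescu_Tulcea_step_kernel[OF M \<delta>]])
  have E [measurable]: "E \<in> ?S n \<rightarrow>\<^sub>M subprob_algebra (?S (Suc n))"
    unfolding E_def by (rule Ionescu_Tulcea.measurable_eP[OF Ionescu_Tulcea_step_kernel[OF M \<delta>]])
  have C_Suc: "(\<integral>\<^sup>+ x. f x \<partial>?C \<gamma>' 0 (Suc n) ?u) = (\<integral>\<^sup>+ x. \<integral>\<^sup>+ y. f y \<partial>E x \<partial>?C \<gamma>' 0 n ?u)" for \<gamma>'
  proof -
    interpret Ionescu_Tulcea "step_kernel M \<delta> \<gamma>' \<zeta>" "\<lambda>_. coord_space"
      by (rule Ionescu_Tulcea_step_kernel[OF M \<delta>])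
    have "E \<in> C 0 n ?u \<rightarrow>\<^sub>M subprob_algebra (?S (Suc n))"
      using E by (simp add: measurable_cong_sets[OF sets_C[OF u] refl])
    from nn_integral_bind[OF step.prems this] show ?thesis
      by (simp add: E_eq)
  qed
  have "(\<lambda>x. \<integral>\<^sup>+ y. f y \<partial>E x) \<in> borel_measurable (?S n)"
    by (rule measurable_compose[OF E nn_integral_measurable_subprob_algebra[OF step.prems]])
  from step.IH[OF this] show ?case
    by (simp only: C_Suc)
qed

lemma emeasure_law_emb:
  assumes "J \<subseteq> {0..<n}" "X \<in> sets (\<Pi>\<^sub>M i\<in>J. coord_space)"
  shows "emeasure (law M \<delta> \<gamma> \<zeta>) (prod_emb UNIV (\<lambda>_. coord_space) J X) =
    (\<integral>\<^sup>+ x. indicator (prod_emb {0..<n} (\<lambda>_. coord_space) J X) x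
      \<partial>Ionescu_Tulcea.C (step_kernel M \<delta> \<gamma> \<zeta>) (\<lambda>_. coord_space) 0 n (\<lambda>_. undefined))"
proof -
  interpret Ionescu_Tulcea "step_kernel M \<delta> \<gamma> \<zeta>" "\<lambda>_. coord_space"
    by (rule Ionescu_Tulcea_step_kernel[OF M \<delta>])
  let ?u = "\<lambda>_. undefined :: bool \<times> 'y"
  have J: "finite J"
    using assms(1) by (rule finite_subset) simp
  have u: "?u \<in> space (\<Pi>\<^sub>M i\<in>{0::nat..<0}. coord_space)"
    by (simp add: space_PiM)
  have "emeasure PF.lim (prod_emb UNIV (\<lambda>_. coord_space) J X) =
      emeasure (C 0 n ?u) (prod_emb {0..<n} (\<lambda>_. coord_space) J X)"
    using lim[OF J assms(2)] emeasure_CI[OF assms] by simp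
  moreover have "prod_emb {0..<n} (\<lambda>_. coord_space) J X \<in> sets (C 0 n ?u)"
    using assms by (simp add: sets_C[OF u])
  ultimately show ?thesis
    by (simp add: law_def)
qed

lemma law_mixture:
  "law M \<delta> \<gamma> \<zeta> =
    measure_pmf (bernoulli_pmf (prior_prob \<gamma>)) \<bind> (\<lambda>l. law M \<delta> (if l then \<infinity> else 0) \<zeta>)"
  (is "_ = ?B")
proof (rule measure_eqI_PiM_infinite[where I = UNIV and M = "\<lambda>_. coord_space"])
  let ?L = "\<lambda>l. law M \<delta> (if l then \<infinity> else 0) \<zeta>"
  let ?P = "\<Pi>\<^sub>M i\<in>UNIV. (coord_space :: (bool \<times> 'y) measure)"
  have L: "?L \<in> measure_pmf (bernoulli_pmf (prior_prob \<gamma>)) \<rightarrow>\<^sub>M subprob_algebra ?P"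
    using sets_law[OF M \<delta>] prob_space_law[OF M \<delta>]
    by (auto simp: space_subprob_algebra prob_space_imp_subprob_space)
  show "sets (law M \<delta> \<gamma> \<zeta>) = sets ?P"
    by (rule sets_law[OF M \<delta>])
  show "sets ?B = sets ?P"
    by (rule sets_bind) (auto simp: sets_law[OF M \<delta>])
  show "finite_measure (law M \<delta> \<gamma> \<zeta>)"
    using prob_space_law[OF M \<delta>] by (rule prob_space.finite_measure)
  fix A and J :: "nat set"
  assume J: "finite J" and A: "\<And>i. i \<in> J \<Longrightarrow> A i \<in> sets (coord_space :: (bool \<times> 'y) measure)"
  let ?X = "prod_emb UNIV (\<lambda>_. coord_space) J (Pi\<^sub>E J A)"
  obtain n where n: "J \<subseteq> {0..<n}" "1 \<le> n"
  proof
    show "J \<subseteq> {0..<Suc (Max (insert 0 J))}" "1 \<le> Suc (Max (insert 0 J))"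
      using J by (auto simp: less_Suc_eq_le)
  qed
  have X: "Pi\<^sub>E J A \<in> sets (\<Pi>\<^sub>M i\<in>J. coord_space)"
    using J A by (rule sets_PiM_I_finite)
  have ind: "indicator (prod_emb {0..<n} (\<lambda>_. coord_space) J (Pi\<^sub>E J A)) \<in>
      borel_measurable (\<Pi>\<^sub>M i\<in>{0::nat..<n}. coord_space)"
    using n X by (intro borel_measurable_indicator) simp
  have "emeasure (law M \<delta> \<gamma> \<zeta>) ?X =
      ennreal (prior_prob \<gamma>) * emeasure (?L True) ?X + ennreal (1 - prior_prob \<gamma>) * emeasure (?L False) ?X"
    using nn_integral_finite_horizon_mixture[OF n(2) ind, of \<gamma> \<zeta>]
    by (simp only: emeasure_law_emb[OF n(1) X] if_True if_False)
  also have "\<dots> = (\<integral>\<^sup>+ l. emeasure (?L l) ?X \<partial>measure_pmf (bernoulli_pmf (prior_prob \<gamma>)))"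
    using prior_prob_bounds[of \<gamma>] by (simp add: mult.commute)
  also have "\<dots> = emeasure ?B ?X"
    using L by (intro emeasure_bind[symmetric]) (use J X in auto)
  finally show "emeasure (law M \<delta> \<gamma> \<zeta>) ?X = emeasure ?B ?X" .
qed

lemma nn_integral_law_mixture:
  assumes f: "f \<in> borel_measurable (\<Pi>\<^sub>M i\<in>UNIV. coord_space)"
  shows "(\<integral>\<^sup>+ \<omega>. f \<omega> \<partial>law M \<delta> \<gamma> \<zeta>) =
    ennreal (prior_prob \<gamma>) * (\<integral>\<^sup>+ \<omega>. f \<omega> \<partial>law M \<delta> \<infinity> \<zeta>) +
    ennreal (1 - prior_prob \<gamma>) * (\<integral>\<^sup>+ \<omega>. f \<omega> \<partial>law M \<delta> 0 \<zeta>)"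
proof -
  let ?L = "\<lambda>l. law M \<delta> (if l then \<infinity> else 0) \<zeta>"
  have "?L \<in> measure_pmf (bernoulli_pmf (prior_prob \<gamma>)) \<rightarrow>\<^sub>M
      subprob_algebra (\<Pi>\<^sub>M i\<in>UNIV. coord_space)"
    using sets_law[OF M \<delta>] prob_space_law[OF M \<delta>]
    by (auto simp: space_subprob_algebra prob_space_imp_subprob_space)
  from nn_integral_bind[OF f this] show ?thesis
    using prior_prob_bounds[of \<gamma>]
    by (subst law_mixture) (simp add: mult.commute)
qed

lemma emeasure_law_not_latent_0:
  "emeasure (law M \<delta> \<gamma> \<zeta>) {\<omega>. \<not> latent 0 \<omega>} = ennreal (1 - prior_prob \<gamma>)"
proof -
  let ?S = "coord_space :: (bool \<times> 'y) measure"
  let ?X = "\<Pi>\<^sub>E i\<in>{0::nat}. {z::bool \<times> 'y. \<not> fst z}"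
  have "Measurable.pred ?S (\<lambda>z. \<not> fst z)"
    unfolding coord_space_def by measurable
  then have "{z. \<not> fst z} \<in> sets ?S"
    by (simp add: pred_def)
  then have X: "?X \<in> sets (\<Pi>\<^sub>M i\<in>{0}. ?S)"
    by (intro sets_PiM_I_finite) auto
  have emb: "prod_emb UNIV (\<lambda>_. ?S) {0} ?X = {\<omega>. \<not> latent 0 \<omega>}"
    by (simp add: prod_emb_def latent_def space_PiM PiE_iff vimage_def)
  have "emeasure (law M \<delta> \<gamma> \<zeta>) {\<omega>. \<not> latent 0 \<omega>} =
      emeasure (law M \<delta> \<gamma> \<zeta>) (prod_emb UNIV (\<lambda>_. ?S) {0} ?X)"
    by (simp add: emb)
  also have "\<dots> = (\<integral>\<^sup>+ x. indicator (prod_emb {0::nat..<1} (\<lambda>_. ?S) {0} ?X) x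
      \<partial>Ionescu_Tulcea.C (step_kernel M \<delta> \<gamma> \<zeta>) (\<lambda>_. ?S) 0 1 (\<lambda>_. undefined))"
    by (rule emeasure_law_emb[OF _ X]) simp
  also have "\<dots> = (\<integral>\<^sup>+ l. indicator (prod_emb {0::nat..<1} (\<lambda>_. ?S) {0} ?X) ((\<lambda>_. undefined)(0 := (l, undefined)))
      \<partial>measure_pmf (bernoulli_pmf (prior_prob \<gamma>)))"
    by (rule nn_integral_initial_step) (use X in \<open>auto intro!: borel_measurable_indicator\<close>)
  also have "\<dots> = ennreal (1 - prior_prob \<gamma>)"
    using prior_prob_bounds[of \<gamma>] by (simp add: prod_emb_def PiE_iff indicator_def extensional_def)
  finally show ?thesis .
qed

lemma measurable_pred_filt:
  assumes "Measurable.pred (filt M \<delta> t) P"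
  shows "Measurable.pred (\<Pi>\<^sub>M i\<in>UNIV. coord_space) P"
proof -
  let ?P = "\<Pi>\<^sub>M i\<in>(UNIV :: nat set). (coord_space :: (bool \<times> 'y) measure)"
  have "(\<lambda>\<omega>. \<lambda>s\<in>{1..t}. (treatment \<delta> s \<omega>, response s \<omega>)) \<in> ?P \<rightarrow>\<^sub>M hist_space M {1..t}"
    unfolding hist_space_def
  proof (intro measurable_restrict measurable_Pair)
    fix s assume "s \<in> {1..t}"
    then show "treatment \<delta> s \<in> ?P \<rightarrow>\<^sub>M count_space {1..arms M}"
      by (intro treatment_measurable[OF \<delta>]) auto
    have "(\<lambda>\<omega>. \<omega> s) \<in> ?P \<rightarrow>\<^sub>M coord_space"
      by (intro measurable_component_singleton) auto
    then show "response s \<in> ?P \<rightarrow>\<^sub>M borel"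
      unfolding response_def coord_space_def by measurable
  qed
  then have "(\<lambda>\<omega>. \<omega>) \<in> ?P \<rightarrow>\<^sub>M filt M \<delta> t"
    unfolding filt_def by (intro measurable_vimage_algebra2) auto
  from measurable_compose[OF this assms] show ?thesis .
qed

lemma measurable_change_point:
  "Measurable.pred (\<Pi>\<^sub>M i\<in>UNIV. coord_space) (\<lambda>\<omega> :: 'y path. change_point \<omega> \<le> enat t)"
proof -
  let ?P = "\<Pi>\<^sub>M i\<in>(UNIV :: nat set). (coord_space :: (bool \<times> 'y) measure)"
  have [measurable]: "Measurable.pred ?P (latent s)" for s
  proof -
    have "(\<lambda>\<omega>. \<omega> s) \<in> ?P \<rightarrow>\<^sub>M coord_space"
      by (intro measurable_component_singleton) auto
    then show ?thesis
      unfolding latent_def coord_space_def by measurable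
  qed
  have "change_point \<omega> \<le> enat t \<longleftrightarrow> (\<exists>s\<le>t. latent s \<omega>)" for \<omega> :: "'y path"
  proof
    assume "change_point \<omega> \<le> enat t"
    then have "(INF s\<in>{s. latent s \<omega>}. enat s) < enat (Suc t)"
      by (simp add: change_point_def order_le_less_trans)
    then show "\<exists>s\<le>t. latent s \<omega>"
      by (auto simp: INF_less_iff less_Suc_eq_le)
  next
    assume "\<exists>s\<le>t. latent s \<omega>"
    then show "change_point \<omega> \<le> enat t"
      by (auto simp: change_point_def intro: INF_lower2)
  qed
  then show ?thesis
    by simp
qed

context
  fixes T :: "'y path \<Rightarrow> enat"
  assumes T: "\<And>t. Measurable.pred (filt M \<delta> t) (\<lambda>\<omega>. T \<omega> \<le> enat t)"
begin

lemma measurable_stopping_time: "T \<in> (\<Pi>\<^sub>M i\<in>UNIV. coord_space) \<rightarrow>\<^sub>M count_space UNIV"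
proof -
  note [measurable] = measurable_pred_filt[OF T]
  have "Measurable.pred (\<Pi>\<^sub>M i\<in>UNIV. coord_space) (\<lambda>\<omega>. T \<omega> = a)" for a
  proof (cases a)
    case (enat n)
    have "T \<omega> = a \<longleftrightarrow> T \<omega> \<le> enat n \<and> (\<forall>m<n. \<not> T \<omega> \<le> enat m)" for \<omega>
      using enat by (cases "T \<omega>") (auto simp: not_le le_less)
    then show ?thesis
      by simp
  next
    case infinity
    have "T \<omega> = a \<longleftrightarrow> (\<forall>m. \<not> T \<omega> \<le> enat m)" for \<omega>
      using infinity by (cases "T \<omega>") auto
    then show ?thesis
      by simp
  qed
  then have "{\<omega> \<in> space (\<Pi>\<^sub>M i\<in>UNIV. coord_space). T \<omega> = a} \<in> sets (\<Pi>\<^sub>M i\<in>UNIV. coord_space)" for a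
    by (rule predE)
  then show ?thesis
    by (simp add: measurable_count_space_eq2_countable vimage_def Int_def conj_commute)
qed

lemma sets_early_stop: "{\<omega>. T \<omega> < change_point \<omega>} \<in> sets (\<Pi>\<^sub>M i\<in>UNIV. coord_space)"
proof -
  note [measurable] = measurable_pred_filt[OF T] measurable_change_point
  have "T \<omega> < change_point \<omega> \<longleftrightarrow> (\<exists>t. T \<omega> \<le> enat t \<and> \<not> change_point \<omega> \<le> enat t)" for \<omega>
  proof
    assume less: "T \<omega> < change_point \<omega>"
    then show "\<exists>t. T \<omega> \<le> enat t \<and> \<not> change_point \<omega> \<le> enat t"
      by (cases "T \<omega>") (auto simp: not_le)
  next
    assume "\<exists>t. T \<omega> \<le> enat t \<and> \<not> change_point \<omega> \<le> enat t"
    then show "T \<omega> < change_point \<omega>"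
      by (auto simp: not_le intro: order_le_less_trans)
  qed
  then have "Measurable.pred (\<Pi>\<^sub>M i\<in>UNIV. coord_space) (\<lambda>\<omega>. T \<omega> < change_point \<omega>)"
    by simp
  then show ?thesis
    by (simp add: pred_def space_PiM)
qed

lemma aux_cost_affine:
  assumes "0 \<le> \<gamma>"
  shows "(1 + ennreal \<gamma>) * aux_cost M c (ennreal \<gamma>) \<zeta> \<delta> T =
    ennreal \<gamma> * aux_cost M c \<infinity> \<zeta> \<delta> T + aux_cost M c 0 \<zeta> \<delta> T"
proof -
  define p where "p = prior_prob (ennreal \<gamma>)"
  have p: "0 \<le> p" "p \<le> 1" "(1 + \<gamma>) * p = \<gamma>" "(1 + \<gamma>) * (1 - p) = 1"
    unfolding p_def using assms prior_prob_bounds[of "ennreal \<gamma>"]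
    by (auto simp: prior_prob_def field_simps)
  have "(\<lambda>\<omega>. ennreal_of_enat (T \<omega>)) \<in> borel_measurable (\<Pi>\<^sub>M i\<in>UNIV. coord_space)"
    by (rule measurable_compose[OF measurable_stopping_time]) simp
  note 1 = nn_integral_law_mixture[OF this, of "ennreal \<gamma>" \<zeta>, folded p_def]
  have "emeasure (law M \<delta> \<gamma>' \<zeta>) {\<omega>. T \<omega> < change_point \<omega>} =
      (\<integral>\<^sup>+ \<omega>. indicator {\<omega>. T \<omega> < change_point \<omega>} \<omega> \<partial>law M \<delta> \<gamma>' \<zeta>)" for \<gamma>'
    using sets_early_stop by (simp add: sets_law[OF M \<delta>])
  then have 2: "emeasure (law M \<delta> (ennreal \<gamma>) \<zeta>) {\<omega>. T \<omega> < change_point \<omega>} =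
      ennreal p * emeasure (law M \<delta> \<infinity> \<zeta>) {\<omega>. T \<omega> < change_point \<omega>} +
      ennreal (1 - p) * emeasure (law M \<delta> 0 \<zeta>) {\<omega>. T \<omega> < change_point \<omega>}"
    using nn_integral_law_mixture[OF borel_measurable_indicator[OF sets_early_stop], of "ennreal \<gamma>" \<zeta>]
    by (simp only: p_def)
  have "aux_cost M c (ennreal \<gamma>) \<zeta> \<delta> T =
      ennreal p * aux_cost M c \<infinity> \<zeta> \<delta> T + ennreal (1 - p) * aux_cost M c 0 \<zeta> \<delta> T"
    unfolding aux_cost_def 1 2 by (simp only: distrib_left ac_simps)
  moreover have "(1 + ennreal \<gamma>) * ennreal p = ennreal \<gamma>" "(1 + ennreal \<gamma>) * ennreal (1 - p) = 1"
    using p assms by (simp_all flip: ennreal_plus ennreal_1 ennreal_mult)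
  ultimately show ?thesis
    by (simp add: distrib_left mult.assoc[symmetric])
qed

lemma aux_cost_bounded_finite:
  assumes "\<And>\<omega>. T \<omega> \<le> enat n"
  shows "aux_cost M c \<gamma> \<zeta> \<delta> T < \<infinity>"
proof -
  interpret prob_space "law M \<delta> \<gamma> \<zeta>"
    by (rule prob_space_law[OF M \<delta>])
  have "(\<integral>\<^sup>+ \<omega>. ennreal_of_enat (T \<omega>) \<partial>law M \<delta> \<gamma> \<zeta>) \<le> (\<integral>\<^sup>+ \<omega>. of_nat n \<partial>law M \<delta> \<gamma> \<zeta>)"
    using assms by (intro nn_integral_mono) (simp flip: ennreal_of_enat_enat)
  also have "\<dots> < \<infinity>"
    by (simp add: emeasure_space_1 of_nat_less_top)
  finally have "ennreal c * (\<integral>\<^sup>+ \<omega>. ennreal_of_enat (T \<omega>) \<partial>law M \<delta> \<gamma> \<zeta>) < \<infinity>"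
    by (simp add: ennreal_mult_less_top)
  then show ?thesis
    unfolding aux_cost_def by (simp add: emeasure_finite less_top[symmetric])
qed

lemma truncated_stopping_time:
  "Measurable.pred (filt M \<delta> t) (\<lambda>\<omega>. min (T \<omega>) (enat n) \<le> enat t)"
  using T[of t] by (simp add: min_le_iff_disj)

lemma aux_cost_truncated_less:
  assumes c: "0 < c" and less: "aux_cost M c \<gamma> \<zeta> \<delta> T < r"
  shows "\<exists>n. aux_cost M c \<gamma> \<zeta> \<delta> (\<lambda>\<omega>. min (T \<omega>) (enat n)) < r"
proof -
  let ?L = "law M \<delta> \<gamma> \<zeta>"
  let ?e = "\<integral>\<^sup>+ \<omega>. ennreal_of_enat (T \<omega>) \<partial>?L"
  let ?a = "aux_cost M c \<gamma> \<zeta> \<delta> T"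
  have [measurable]: "T \<in> ?L \<rightarrow>\<^sub>M count_space UNIV"
    unfolding measurable_cong_sets[OF sets_law[OF M \<delta>] refl] by (rule measurable_stopping_time)
  have space: "space ?L = UNIV"
    using sets_eq_imp_space_eq[OF sets_law[OF M \<delta>]] by (simp add: space_PiM)
  have "ennreal c * ?e < \<infinity>"
    using less by (auto simp: aux_cost_def less_top[symmetric] top_unique)
  then have e: "?e < \<infinity>"
    using c by (auto simp: ennreal_mult_less_top)
  have tail: "emeasure ?L {\<omega>. enat n < T \<omega>} \<le> ennreal (1 / Suc n) * ?e" for n
  proof -
    have "{\<omega>. enat n < T \<omega>} \<subseteq> {\<omega> \<in> space ?L. 1 \<le> ennreal (1 / Suc n) * ennreal_of_enat (T \<omega>)}"
    proof safe
      fix \<omega> assume "enat n < T \<omega>"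
      then have "enat (Suc n) \<le> T \<omega>"
        by (simp add: Suc_ile_eq)
      then have "ennreal (1 / Suc n) * of_nat (Suc n) \<le> ennreal (1 / Suc n) * ennreal_of_enat (T \<omega>)"
        by (intro mult_left_mono) (auto simp flip: ennreal_of_enat_enat)
      also have "ennreal (1 / Suc n) * of_nat (Suc n) = 1"
        by (simp add: ennreal_of_nat_eq_real_of_nat flip: ennreal_mult del: of_nat_Suc)
      finally show "1 \<le> ennreal (1 / Suc n) * ennreal_of_enat (T \<omega>)" .
    qed (simp add: space)
    then have "emeasure ?L {\<omega>. enat n < T \<omega>} \<le>
        emeasure ?L {\<omega> \<in> space ?L. 1 \<le> ennreal (1 / Suc n) * ennreal_of_enat (T \<omega>)}"
      by (rule emeasure_mono) measurable
    also have "\<dots> \<le> ennreal (1 / Suc n) * (\<integral>\<^sup>+ \<omega>. ennreal_of_enat (T \<omega>) * indicator (space ?L) \<omega> \<partial>?L)"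
      by (intro nn_integral_Markov_inequality) auto
    finally show ?thesis
      by (simp add: space)
  qed
  have trunc: "aux_cost M c \<gamma> \<zeta> \<delta> (\<lambda>\<omega>. min (T \<omega>) (enat n)) \<le> ?a + ennreal (1 / Suc n) * ?e" for n
  proof -
    let ?A = "{\<omega>. T \<omega> < change_point \<omega>}" and ?B = "{\<omega>. enat n < T \<omega>}"
    have A: "?A \<in> sets ?L"
      using sets_early_stop by (simp add: sets_law[OF M \<delta>])
    have "T -` {enat n<..} \<inter> space (\<Pi>\<^sub>M i\<in>UNIV. coord_space) \<in> sets (\<Pi>\<^sub>M i\<in>UNIV. coord_space)"
      by (rule measurable_sets[OF measurable_stopping_time]) simp
    then have B: "?B \<in> sets ?L"
      by (simp add: sets_law[OF M \<delta>] space_PiM vimage_def greaterThan_def)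
    have "emeasure ?L {\<omega>. min (T \<omega>) (enat n) < change_point \<omega>} \<le> emeasure ?L (?A \<union> ?B)"
      using A B by (intro emeasure_mono) (auto simp: min_def split: if_splits)
    also have "\<dots> \<le> emeasure ?L ?A + emeasure ?L ?B"
      using A B by (rule emeasure_subadditive)
    also have "\<dots> \<le> emeasure ?L ?A + ennreal (1 / Suc n) * ?e"
      by (intro add_left_mono tail)
    finally have "emeasure ?L {\<omega>. min (T \<omega>) (enat n) < change_point \<omega>} \<le>
        emeasure ?L ?A + ennreal (1 / Suc n) * ?e" .
    moreover have "ennreal c * (\<integral>\<^sup>+ \<omega>. ennreal_of_enat (min (T \<omega>) (enat n)) \<partial>?L) \<le> ennreal c * ?e"
      by (intro mult_left_mono nn_integral_mono) auto
    ultimately show ?thesis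
      unfolding aux_cost_def add.assoc by (rule add_mono[rotated])
  qed
  have "(\<lambda>n. ennreal (1 / Suc n)) \<longlonglongrightarrow> ennreal 0"
    by (intro tendsto_ennrealI lim_1_over_n[THEN LIMSEQ_Suc])
  then have "(\<lambda>n. ?a + ennreal (1 / Suc n) * ?e) \<longlonglongrightarrow> ?a + ennreal 0 * ?e"
    using e by (intro tendsto_add tendsto_const tendsto_mult_ennreal) auto
  then have "\<forall>\<^sub>F n in sequentially. ?a + ennreal (1 / Suc n) * ?e < r"
    using less by (intro order_tendstoD) auto
  then obtain n where "?a + ennreal (1 / Suc n) * ?e < r"
    by (auto simp: eventually_sequentially)
  with trunc[of n] show ?thesis
    by (blast intro: order_le_less_trans)
qed

lemma stopping_time_zero_or_pos: "(\<forall>\<omega>. T \<omega> = 0) \<or> (\<forall>\<omega>. 1 \<le> T \<omega>)"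
proof -
  have "{\<omega>. T \<omega> \<le> enat 0} \<in> sets (filt M \<delta> 0)"
    using T[of 0] by (simp add: pred_def filt_def)
  then obtain A where "{\<omega>. T \<omega> \<le> enat 0} = (\<lambda>\<omega>. \<lambda>s\<in>{1..0}. (treatment \<delta> s \<omega>, response s \<omega>)) -` A"
    unfolding filt_def by (subst (asm) sets_vimage_algebra2) (auto simp: hist_space_def space_PiM)
  then have "T \<omega> \<le> enat 0 \<longleftrightarrow> (\<lambda>_. undefined) \<in> A" for \<omega>
    by (auto simp: set_eq_iff restrict_def)
  then have "T \<omega> = 0 \<longleftrightarrow> (\<lambda>_. undefined) \<in> A" for \<omega>
    by (simp flip: zero_enat_def)
  then show ?thesis
    by (cases "(\<lambda>_. undefined) \<in> A") (auto simp: one_eSuc intro!: ileI1 zero_less_iff_neq_zero[THEN iffD2])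
qed

lemma aux_cost_ge_const:
  assumes "\<And>\<omega>. 1 \<le> T \<omega>"
  shows "ennreal c \<le> aux_cost M c \<gamma> \<zeta> \<delta> T"
proof -
  interpret prob_space "law M \<delta> \<gamma> \<zeta>"
    by (rule prob_space_law[OF M \<delta>])
  have "1 = (\<integral>\<^sup>+ \<omega>. 1 \<partial>law M \<delta> \<gamma> \<zeta>)"
    by (simp add: emeasure_space_1)
  also have "\<dots> \<le> (\<integral>\<^sup>+ \<omega>. ennreal_of_enat (T \<omega>) \<partial>law M \<delta> \<gamma> \<zeta>)"
    using assms by (intro nn_integral_mono) (simp flip: ennreal_of_enat_1)
  finally have "ennreal c * 1 \<le> ennreal c * (\<integral>\<^sup>+ \<omega>. ennreal_of_enat (T \<omega>) \<partial>law M \<delta> \<gamma> \<zeta>)"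
    by (rule mult_left_mono) simp
  then show ?thesis
    unfolding aux_cost_def by (simp add: add_increasing2)
qed

lemma aux_cost_no_observation:
  assumes "\<And>\<omega>. T \<omega> = 0"
  shows "aux_cost M c 0 \<zeta> \<delta> T = 1"
proof -
  have "0 < change_point \<omega> \<longleftrightarrow> \<not> latent 0 \<omega>" for \<omega> :: "'y path"
  proof
    assume "0 < change_point \<omega>"
    then show "\<not> latent 0 \<omega>"
      using INF_lower[of 0 "{t. latent t \<omega>}" enat] by (auto simp: change_point_def zero_enat_def)
  next
    assume 0: "\<not> latent 0 \<omega>"
    have "1 \<le> change_point \<omega>"
      unfolding change_point_def
    proof (rule INF_greatest)
      fix t assume "t \<in> {t. latent t \<omega>}"
      with 0 have "t \<noteq> 0"
        by (cases t) auto
      then show "1 \<le> enat t"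
        by (simp add: one_enat_def)
    qed
    then show "0 < change_point \<omega>"
      by (rule order_less_le_trans[rotated]) simp
  qed
  then show ?thesis
    using emeasure_law_not_latent_0[of 0 \<zeta>] assms by (simp add: aux_cost_def prior_prob_def)
qed

end

end

lemma stop_iff:
  fixes M :: "('y::polish_space) cp_model"
  assumes M: "markov_model M" and \<gamma>: "0 \<le> \<gamma>"
  shows "1 / (1 + ennreal \<gamma>) \<le> opt_cost M c (ennreal \<gamma>) \<zeta> False \<longleftrightarrow>
    (\<forall>(\<delta>, T)\<in>procedures M. 1 \<le> ennreal \<gamma> * aux_cost M c \<infinity> \<zeta> \<delta> T + aux_cost M c 0 \<zeta> \<delta> T)"
proof -
  have "1 / (1 + ennreal \<gamma>) \<le> x \<longleftrightarrow> 1 \<le> (1 + ennreal \<gamma>) * x" for x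
  proof
    assume "1 / (1 + ennreal \<gamma>) \<le> x"
    then have "(1 + ennreal \<gamma>) * (1 / (1 + ennreal \<gamma>)) \<le> (1 + ennreal \<gamma>) * x"
      by (rule mult_left_mono) simp
    then show "1 \<le> (1 + ennreal \<gamma>) * x"
      by (simp add: ennreal_times_divide)
  next
    assume "1 \<le> (1 + ennreal \<gamma>) * x"
    then show "1 / (1 + ennreal \<gamma>) \<le> x"
      by (intro divide_le_posI_ennreal) (auto simp: add_pos_nonneg)
  qed
  then show ?thesis
    by (auto simp: opt_cost_def le_INF_iff procedures_def aux_cost_affine[OF M _ _ \<gamma>])
qed

lemma stop_mono:
  fixes M :: "('y::polish_space) cp_model"
  assumes M: "markov_model M" and \<gamma>: "0 \<le> \<gamma>" "\<gamma> \<le> \<gamma>'"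
    and stop: "1 / (1 + ennreal \<gamma>) \<le> opt_cost M c (ennreal \<gamma>) \<zeta> False"
  shows "1 / (1 + ennreal \<gamma>') \<le> opt_cost M c (ennreal \<gamma>') \<zeta> False"
proof -
  have "ennreal \<gamma> * x + y \<le> ennreal \<gamma>' * x + y" for x y :: ennreal
    using \<gamma> by (intro add_mono mult_right_mono) (auto simp: ennreal_leI)
  then show ?thesis
    using stop \<gamma> unfolding stop_iff[OF M \<gamma>(1)] stop_iff[OF M order_trans[OF \<gamma>]]
    by (fastforce intro: order_trans)
qed

lemma stop_large:
  fixes M :: "('y::polish_space) cp_model"
  assumes M: "markov_model M" and c: "0 < c"
  shows "1 / (1 + ennreal (1 / c)) \<le> opt_cost M c (ennreal (1 / c)) \<zeta> False"
proof -
  have pos: "0 \<le> 1 / c"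
    using c by simp
  have "1 \<le> ennreal (1 / c) * aux_cost M c \<infinity> \<zeta> \<delta> T + aux_cost M c 0 \<zeta> \<delta> T"
    if "(\<delta>, T) \<in> procedures M" for \<delta> T
  proof -
    from that have \<delta>: "assignment_rule M \<delta>"
      and T: "\<And>t. Measurable.pred (filt M \<delta> t) (\<lambda>\<omega>. T \<omega> \<le> enat t)"
      by (auto simp: procedures_def)
    from stopping_time_zero_or_pos[OF M \<delta> T] show ?thesis
    proof
      assume "\<forall>\<omega>. T \<omega> = 0"
      then have "aux_cost M c 0 \<zeta> \<delta> T = 1"
        by (intro aux_cost_no_observation[OF M \<delta> T]) simp
      then show ?thesis
        by simp
    next
      assume "\<forall>\<omega>. 1 \<le> T \<omega>"
      then have "ennreal (1 / c) * ennreal c \<le> ennreal (1 / c) * aux_cost M c \<infinity> \<zeta> \<delta> T"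
        by (intro mult_left_mono aux_cost_ge_const[OF M \<delta> T]) auto
      moreover have "ennreal (1 / c) * ennreal c = 1"
        using c by (simp flip: ennreal_mult)
      ultimately show ?thesis
        by (simp add: add_increasing2)
    qed
  qed
  then show ?thesis
    unfolding stop_iff[OF M pos] by auto
qed

lemma continue_open:
  fixes M :: "('y::polish_space) cp_model"
  assumes M: "markov_model M" and c: "0 < c" and \<gamma>: "0 \<le> \<gamma>"
    and continue: "\<not> 1 / (1 + ennreal \<gamma>) \<le> opt_cost M c (ennreal \<gamma>) \<zeta> False"
  shows "\<exists>\<gamma>'>\<gamma>. \<not> 1 / (1 + ennreal \<gamma>') \<le> opt_cost M c (ennreal \<gamma>') \<zeta> False"
proof -
  from continue obtain \<delta> T where "(\<delta>, T) \<in> procedures M"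
    and less: "aux_cost M c (ennreal \<gamma>) \<zeta> \<delta> T < 1 / (1 + ennreal \<gamma>)"
    by (auto simp: opt_cost_def not_le INF_less_iff)
  then have \<delta>: "assignment_rule M \<delta>"
    and T: "\<And>t. Measurable.pred (filt M \<delta> t) (\<lambda>\<omega>. T \<omega> \<le> enat t)"
    by (auto simp: procedures_def)
  from aux_cost_truncated_less[OF M \<delta> T c less] obtain n
    where n: "aux_cost M c (ennreal \<gamma>) \<zeta> \<delta> (\<lambda>\<omega>. min (T \<omega>) (enat n)) < 1 / (1 + ennreal \<gamma>)"
    by blast
  define S where "S = (\<lambda>\<omega>. min (T \<omega>) (enat n))"
  have S: "Measurable.pred (filt M \<delta> t) (\<lambda>\<omega>. S \<omega> \<le> enat t)" for t
    unfolding S_def by (rule truncated_stopping_time[OF M \<delta> T])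
  have fin: "aux_cost M c \<gamma>' \<zeta> \<delta> S < \<infinity>" for \<gamma>'
    by (rule aux_cost_bounded_finite[OF M \<delta> S, where n = n]) (simp add: S_def)
  define u v where "u = enn2real (aux_cost M c \<infinity> \<zeta> \<delta> S)" and "v = enn2real (aux_cost M c 0 \<zeta> \<delta> S)"
  have uv: "aux_cost M c \<infinity> \<zeta> \<delta> S = ennreal u" "aux_cost M c 0 \<zeta> \<delta> S = ennreal v" "0 \<le> u" "0 \<le> v"
    using fin by (auto simp: u_def v_def less_top)
  have affine: "(1 + ennreal x) * aux_cost M c (ennreal x) \<zeta> \<delta> S = ennreal (x * u + v)" if "0 \<le> x" for x
    using that uv by (simp add: aux_cost_affine[OF M \<delta> S that] ennreal_mult)
  have cheap: "\<not> 1 \<le> (1 + ennreal \<gamma>) * aux_cost M c (ennreal \<gamma>) \<zeta> \<delta> S"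
  proof
    assume "1 \<le> (1 + ennreal \<gamma>) * aux_cost M c (ennreal \<gamma>) \<zeta> \<delta> S"
    then have "1 / (1 + ennreal \<gamma>) \<le> aux_cost M c (ennreal \<gamma>) \<zeta> \<delta> S"
      by (intro divide_le_posI_ennreal) (auto simp: add_pos_nonneg)
    with n show False
      by (simp add: S_def)
  qed
  define d where "d = 1 - (\<gamma> * u + v)"
  define \<gamma>' where "\<gamma>' = \<gamma> + d / (u + 1)"
  have d: "0 < d"
    using \<gamma> cheap by (simp add: affine d_def not_le)
  then have "\<gamma> < \<gamma>'"
    using uv by (simp add: \<gamma>'_def)
  moreover have "\<gamma>' * u + v < 1"
  proof -
    have "\<gamma>' * u + v = 1 - d + d * (u / (u + 1))"
      by (simp add: \<gamma>'_def d_def distrib_right)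
    moreover have "d * (u / (u + 1)) < d * 1"
      using d uv by (intro mult_strict_left_mono) auto
    ultimately show ?thesis
      by linarith
  qed
  moreover have "(\<delta>, S) \<in> procedures M"
    using \<delta> S by (simp add: procedures_def)
  ultimately show ?thesis
    using \<gamma> uv by (intro exI[of _ \<gamma>'])
      (auto simp: stop_iff[OF M] not_le simp flip: ennreal_mult ennreal_plus intro!: bexI[of _ "(\<delta>, S)"])
qed

theorem theorem3p1:
  fixes M :: "('y::polish_space) cp_model" and c :: real
  assumes "markov_model M" and "c > 0"
  shows "\<exists>b :: (nat \<Rightarrow> real) \<Rightarrow> real.
    (\<forall>s\<in>euclid (stat_dim M). 0 \<le> b s) \<and>
    (\<forall>(\<gamma>::real) \<zeta> \<Gamma> \<delta> T. 0 \<le> \<gamma> \<longrightarrow> \<zeta> \<in> euclid (stat_dim M) \<longrightarrow>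
       star_procedure M c (ennreal \<gamma>) \<zeta> \<Gamma> \<delta> T \<longrightarrow>
       (\<forall>\<omega>. T \<omega> = (INF t\<in>{t. \<Gamma> t \<omega> \<ge> ennreal (b (suff_stat M \<delta> \<zeta> t \<omega>))}. enat t))) \<and>
    (stat_dim M = 0 \<longrightarrow> b constant_on euclid (stat_dim M))"
proof -
  define stop where "stop \<gamma> s \<longleftrightarrow> 1 / (1 + \<gamma>) \<le> opt_cost M c \<gamma> s False" for \<gamma> s
  define b where "b s = Inf {\<gamma>. 0 \<le> \<gamma> \<and> stop (ennreal \<gamma>) s}" for s
  have ne: "1 / c \<in> {\<gamma>. 0 \<le> \<gamma> \<and> stop (ennreal \<gamma>) s}" for s
    using assms stop_large[OF assms, of s] by (simp add: stop_def)
  have bdd: "bdd_below {\<gamma>. 0 \<le> \<gamma> \<and> stop (ennreal \<gamma>) s}" for s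
    by (rule bdd_belowI[of _ 0]) simp
  have b_nonneg: "0 \<le> b s" for s
    unfolding b_def
  proof (rule cInf_greatest)
    show "{\<gamma>. 0 \<le> \<gamma> \<and> stop (ennreal \<gamma>) s} \<noteq> {}"
      using ne[of s] by blast
  qed simp
  have stop_b: "stop (ennreal (b s)) s" for s
  proof (rule ccontr)
    assume "\<not> stop (ennreal (b s)) s"
    then obtain \<gamma> where \<gamma>: "b s < \<gamma>" "\<not> stop (ennreal \<gamma>) s"
      using continue_open[OF assms b_nonneg] by (auto simp: stop_def)
    from \<gamma>(1) obtain x where "x < \<gamma>" "0 \<le> x" "stop (ennreal x) s"
      unfolding b_def using cInf_less_iff[OF _ bdd] ne[of s] by blast
    with \<gamma>(2) show False
      using stop_mono[OF assms(1), of x \<gamma> c s] by (simp add: stop_def)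
  qed
  have stop_iff_b: "stop \<gamma> s \<longleftrightarrow> ennreal (b s) \<le> \<gamma>" for \<gamma> s
  proof (cases \<gamma>)
    case (real x)
    show ?thesis
    proof
      assume "stop \<gamma> s"
      then have "b s \<le> x"
        unfolding b_def using real by (intro cInf_lower bdd) auto
      then show "ennreal (b s) \<le> \<gamma>"
        using real by (simp add: ennreal_leI)
    next
      assume "ennreal (b s) \<le> \<gamma>"
      then show "stop \<gamma> s"
        using real stop_b[of s] stop_mono[OF assms(1) b_nonneg, of s x c s] by (simp add: stop_def)
    qed
  qed (simp add: stop_def)
  show ?thesis
  proof (intro exI[of _ b] conjI ballI allI impI)
    show "0 \<le> b s" for s
      by (rule b_nonneg)
    fix \<gamma> :: real and \<zeta> \<Gamma> \<delta> T \<omega>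
    assume "star_procedure M c (ennreal \<gamma>) \<zeta> \<Gamma> \<delta> T"
    then show "T \<omega> = (INF t\<in>{t. \<Gamma> t \<omega> \<ge> ennreal (b (suff_stat M \<delta> \<zeta> t \<omega>))}. enat t)"
      by (simp add: star_procedure_def flip: stop_iff_b) (simp add: stop_def)
  next
    assume "stat_dim M = 0"
    then show "b constant_on euclid (stat_dim M)"
      by (auto simp: constant_on_def euclid_def)
  qed
qed

end
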